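(* Let $m\ge 4$ and $n\ge \frac{m(m-1)}{2}$ be integers. Then \[RS_m(n)=\left\lceil \frac{(m-3)n+\frac{m(m-1)}{2}}{m-2}\right\rceil.\]
   Context: For $m\ge 3$, $E_m$ denotes the equation $x_1+x_2+\cdots+x_{m-1}=x_m$. For a positive integer $n$, $[1,n]=\{1,2,\ldots,n\}$. An $r$-coloring of a set $S$ is a map $S\to\{1,\ldots,r\}$; it is exact if it is surjective. A solution to $E_m$ in $[1,n]$ is a tuple $(x_1,\ldots,x_m)$ of elements of $[1,n]$ satisfying $E_m$; under a coloring it is rainbow if the $m$ elements $x_1,\ldots,x_m$ receive pairwise distinct colors. For $m\ge 3$ and $n\ge \frac{m(m-1)}{2}$, the rainbow Schur number $RS_m(n)$ is the minimum positive integer $r$ such that every exact $r$-coloring of $[1,n]$ admits a rainbow solution to $E_m$ in $[1,n]$. *)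

theory Defs
  imports Complex_Main "HOL-Library.FuncSet"
begin

definition coloring :: "nat \<Rightarrow> nat set \<Rightarrow> (nat \<Rightarrow> nat) \<Rightarrow> bool" where
  "coloring r S c \<longleftrightarrow> c \<in> S \<rightarrow> {1..r}"

definition exact_coloring :: "nat \<Rightarrow> nat set \<Rightarrow> (nat \<Rightarrow> nat) \<Rightarrow> bool" where
  "exact_coloring r S c \<longleftrightarrow> coloring r S c \<and> c ` S = {1..r}"

text \<open>A tuple \<open>(x\<^sub>1, \<dots>, x\<^sub>m)\<close> is a function on indices, of which only the values
  at \<open>1, \<dots>, m\<close> matter.\<close>

definition solution :: "nat \<Rightarrow> nat \<Rightarrow> (nat \<Rightarrow> nat) \<Rightarrow> bool" where
  "solution m n x \<longleftrightarrow> x \<in> {1..m} \<rightarrow> {1..n} \<and> (\<Sum>i = 1..m - 1. x i) = x m"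

definition rainbow :: "nat \<Rightarrow> (nat \<Rightarrow> nat) \<Rightarrow> (nat \<Rightarrow> nat) \<Rightarrow> bool" where
  "rainbow m c x \<longleftrightarrow> inj_on (\<lambda>i. c (x i)) {1..m}"

text \<open>The minimum is over a nonempty set for all \<open>m\<close> and \<open>n\<close>: there is no exact
  \<open>(n + 1)\<close>-coloring of \<open>{1..n}\<close>, so \<open>r = n + 1\<close> qualifies vacuously.  For \<open>n > 0\<close> the
  same holds of \<open>r = 0\<close>, which is why positivity is required.\<close>

definition rainbow_schur :: "nat \<Rightarrow> nat \<Rightarrow> nat" where
  "rainbow_schur m n =
     (LEAST r. 0 < r \<and>
        (\<forall>c. exact_coloring r {1..n} c \<longrightarrow> (\<exists>x. solution m n x \<and> rainbow m c x)))"

end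

theory Submission
  imports Defs
begin

text \<open>
  Put \<open>q = \<lfloor>(n - m (m - 1) / 2) / (m - 2)\<rfloor>\<close>; the right-hand side is \<open>n - q\<close>.
  Giving \<open>1, \<dots>, q + 2\<close> one color and all other numbers different colors uses \<open>n - q - 1\<close> colors,
  and \<open>m - 1\<close> differently colored numbers then have a sum exceeding \<open>n\<close>; merging colors handles
  fewer colors.

  Conversely, in an exact coloring with \<open>n - q\<close> colors, call a number \<^emph>\<open>repeated\<close> if its color
  occurs at a smaller number, so that there are \<open>q\<close> repeated numbers.  Let \<open>A\<close> consist of the
  \<open>m - 2\<close> smallest non-repeated numbers, with maximum \<open>a\<close> and sum \<open>s\<close>.  If there is no rainbow
  solution, then for every \<open>x\<close> with \<open>a < x \<le> n - s\<close> the tuple formed by \<open>A\<close>, \<open>x\<close> and \<open>x + s\<close> shows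
  that \<open>x\<close> or \<open>x + s\<close> is repeated.  Only \<open>u = q - (a - (m - 2))\<close> repeated numbers exceed \<open>a\<close>, and
  each accounts for at most two values of \<open>x\<close>, whereas there are at least
  \<open>u (m - 2) + 1 > 2 u\<close> such values.
\<close>

section \<open>Bounds for sums of distinct natural numbers\<close>

lemma sum_ge_card:
  fixes S :: "nat set"
  assumes "finite S" "0 \<notin> S"
  shows "card S * (card S + 1) \<le> 2 * \<Sum>S"
proof -
  \<comment> \<open>Inserting 0 leaves the sum unchanged and shifts the comparison set
    \<open>{0..<k}\<close> to \<open>{0..k}\<close>.\<close>
  have "\<Sum>{0..<card (insert 0 S)} \<le> \<Sum>(insert 0 S)"
    using assms by (intro card_sum_le_nat_sum)
  then have "\<Sum>{0..card S} \<le> \<Sum>S"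
    using assms by (simp add: atLeastLessThanSuc_atLeastAtMost)
  then show ?thesis
    using double_gauss_sum[of "card S", where 'a = nat] by simp
qed

text \<open>The reflection taking x to a + 1 - x makes all elements positive, so
  \<open>sum_ge_card\<close> applies to the image.\<close>

lemma sum_le_card:
  fixes S :: "nat set"
  assumes "S \<subseteq> {..a}"
  shows "2 * \<Sum>S + card S * (card S - 1) \<le> 2 * card S * a"
proof -
  have fin: "finite S"
    using assms finite_subset by blast
  let ?f = "\<lambda>x. Suc a - x"
  have inj: "inj_on ?f S"
  proof (rule inj_onI)
    fix x y
    assume "x \<in> S" "y \<in> S" "Suc a - x = Suc a - y"
    moreover from this have "x \<le> a" "y \<le> a"
      using assms by auto
    ultimately show "x = y"
      by linarith
  qed
  have "card (?f ` S) * (card (?f ` S) + 1) \<le> 2 * \<Sum>(?f ` S)"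
    using fin assms by (intro sum_ge_card) (auto simp: subset_iff Suc_diff_le)
  then have "card S * (card S + 1) \<le> 2 * (\<Sum>x\<in>S. ?f x)"
    using inj by (simp add: card_image sum.reindex)
  moreover have "(\<Sum>x\<in>S. ?f x) + \<Sum>S = card S * Suc a"
  proof -
    have "(\<Sum>x\<in>S. ?f x) + \<Sum>S = (\<Sum>x\<in>S. ?f x + x)"
      by (simp add: sum.distrib)
    also have "\<dots> = (\<Sum>x\<in>S. Suc a)"
      using assms by (intro sum.cong) (auto simp: subset_iff le_SucI)
    finally show ?thesis
      by simp
  qed
  ultimately show ?thesis
    by (cases "card S") (auto simp: algebra_simps)
qed

lemma obtain_smallest_elements:
  fixes R :: "nat set"
  assumes "finite R" "j \<le> card R"
  obtains A where "A \<subseteq> R" "card A = j" "\<And>x y. x \<in> R - A \<Longrightarrow> y \<in> A \<Longrightarrow> y < x"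
proof -
  have "\<exists>A\<subseteq>R. card A = j \<and> (\<forall>x\<in>R - A. \<forall>y\<in>A. y < x)"
    using assms(2)
  proof (induction j)
    case 0
    show ?case
      by (rule exI[of _ "{}"]) auto
  next
    case (Suc j)
    then obtain A where A: "A \<subseteq> R" "card A = j" "\<forall>x\<in>R - A. \<forall>y\<in>A. y < x"
      by auto
    have ne: "R - A \<noteq> {}"
      using A Suc.prems by (metis Diff_eq_empty_iff Suc_n_not_le_n subset_antisym)
    have fin: "finite (R - A)" "finite A"
      using assms(1) A(1) finite_subset by auto
    define z where "z = Min (R - A)"
    have z: "z \<in> R - A" "\<And>x. x \<in> R - A \<Longrightarrow> z \<le> x"
      unfolding z_def using Min_in[OF fin(1) ne] fin(1) by auto
    show ?case
    proof (intro exI[of _ "insert z A"] conjI ballI)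
      show "insert z A \<subseteq> R" "card (insert z A) = Suc j"
        using A z fin by auto
      show "y < x" if "x \<in> R - insert z A" "y \<in> insert z A" for x y
        using that A(3) z(2)[of x] by (cases "x = z") (auto simp: le_neq_implies_less)
    qed
  qed
  then show ?thesis
    using that by blast
qed

section \<open>Upper bound: forcing a rainbow solution\<close>

lemma rainbow_solution_of_set:
  assumes "B \<subseteq> {1..n}" "card B = m - 1" "m > 0" "\<Sum>B \<in> {1..n}" "\<Sum>B \<notin> B"
    and inj: "inj_on c (insert (\<Sum>B) B)"
  shows "\<exists>x. solution m n x \<and> rainbow m c x"
proof -
  have "finite B"
    using assms(1) finite_subset by blast
  then obtain h where h: "bij_betw h {1..m - 1} B"
    using ex_bij_betw_nat_finite_1 assms(2) by metis
  define x where "x = h(m := \<Sum>B)"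
  have m: "{1..m} = insert m {1..m - 1}" "m \<notin> {1..m - 1}"
    using assms(3) by auto
  have xh: "x i = h i" if "i \<in> {1..m - 1}" for i
    using that assms(3) by (auto simp: x_def)
  have bij: "bij_betw x {1..m - 1} B"
    using h xh bij_betw_cong by metis
  then have bij': "bij_betw x {1..m} (insert (\<Sum>B) B)"
    unfolding m(1) using assms(5) m(2) notIn_Un_bij_betw[of m "{1..m - 1}" x B] by (simp add: x_def)
  have "(\<Sum>i = 1..m - 1. x i) = \<Sum>B"
    using sum.reindex_bij_betw[OF bij, of "\<lambda>y. y"] by simp
  moreover have "x ` {1..m} \<subseteq> {1..n}"
    using bij' assms(1,4) by (auto simp: bij_betw_def)
  moreover have "x m = \<Sum>B"
    by (simp add: x_def)
  ultimately have "solution m n x"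
    unfolding solution_def by auto
  moreover have "rainbow m c x"
    unfolding rainbow_def using bij' inj comp_inj_on[of x "{1..m}" c]
    by (simp add: bij_betw_def comp_def)
  ultimately show ?thesis
    by blast
qed

text \<open>Cleared of fractions, assumption \<open>n\<close> says that the number n - r of repeated
  numbers is at most (n - m (m - 1) / 2) / (m - 2).\<close>

lemma exact_coloring_has_rainbow_solution:
  assumes col: "exact_coloring r {1..n} c" and m: "m \<ge> 4"
    and n: "m * (m - 1) + 2 * (n - r) * (m - 2) \<le> 2 * n"
  shows "\<exists>x. solution m n x \<and> rainbow m c x"
proof (rule ccontr)
  assume none: "\<nexists>x. solution m n x \<and> rainbow m c x"
  define q where "q = n - r"
  define j where "j = m - 2"
  have j: "m = j + 2" "j \<ge> 2"
    using m by (auto simp: j_def)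
  have n': "(j + 2) * (j + 1) + 2 * q * j \<le> 2 * n"
    using n by (simp add: j q_def)
  have img: "c ` {1..n} = {1..r}"
    using col by (simp add: exact_coloring_def)
  then have rn: "r \<le> n"
    using card_image_le[of "{1..n}" c] by simp
  \<comment> \<open>\<open>R\<close> takes the first number of each color, so \<open>c\<close> is
    injective on it; \<open>D\<close> consists of the repeated numbers.\<close>
  define R where "R = {x \<in> {1..n}. \<forall>y\<in>{1..<x}. c y \<noteq> c x}"
  define D where "D = {1..n} - R"
  have R: "R \<subseteq> {1..n}" "finite R"
    by (auto simp: R_def)
  have injR: "inj_on c R"
    by (rule inj_onI) (metis (mono_tags, lifting) R_def atLeastLessThan_iff atLeastAtMost_iff
        linorder_neqE_nat mem_Collect_eq)
  have "c ` R = {1..r}"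
  proof
    show "c ` R \<subseteq> {1..r}"
      using img R(1) by blast
    show "{1..r} \<subseteq> c ` R"
    proof
      fix k assume "k \<in> {1..r}"
      then have ex: "\<exists>x. x \<in> {1..n} \<and> c x = k"
        using img by (metis imageE)
      define x where "x = (LEAST x. x \<in> {1..n} \<and> c x = k)"
      have x: "x \<in> {1..n}" "c x = k"
        using LeastI_ex[OF ex] by (auto simp: x_def)
      have "c y \<noteq> c x" if "y \<in> {1..<x}" for y
        using not_less_Least[of y "\<lambda>x. x \<in> {1..n} \<and> c x = k", folded x_def] that x by auto
      then have "x \<in> R"
        using x by (auto simp: R_def)
      then show "k \<in> c ` R"
        using x(2) by blast
    qed
  qed
  then have cardR: "card R = r"
    using injR card_image by fastforce
  have cardD: "card D = q" "finite D"
    using cardR R by (auto simp: D_def q_def card_Diff_subset)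
  have jr: "j \<le> r"
  proof -
    have "q * 2 \<le> q * j"
      using j(2) by (intro mult_le_mono2)
    moreover have "2 * j + 2 * (q * j) \<le> 2 * n"
      using n' by (simp add: algebra_simps)
    moreover have "q + r = n"
      using rn by (simp add: q_def)
    ultimately show ?thesis
      by linarith
  qed
  obtain A where A: "A \<subseteq> R" "card A = j" "\<And>x y. x \<in> R - A \<Longrightarrow> y \<in> A \<Longrightarrow> y < x"
    using obtain_smallest_elements[of R j] R(2) cardR jr by metis
  have finA: "finite A" and neA: "A \<noteq> {}"
    using A(1,2) R(2) j(2) finite_subset by fastforce+
  define a where "a = Max A"
  have a: "a \<in> A" "\<And>x. x \<in> A \<Longrightarrow> x \<le> a"
    using finA neA by (auto simp: a_def)
  define s where "s = \<Sum>A"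
  \<comment> \<open>No number precedes 1, so it lies in \<open>R\<close> and is its least
    element.\<close>
  have one: "1 \<in> A"
  proof (rule ccontr)
    assume "1 \<notin> A"
    moreover have "a \<in> {1..n}"
      using a(1) A(1) R(1) by blast
    ultimately have "a < 1"
      using A(3)[of 1 a] a(1) by (auto simp: R_def)
    with \<open>a \<in> {1..n}\<close> show False
      by simp
  qed
  have below: "{1..a} - D = A"
    using A a R(1) by (fastforce simp: D_def)
  have an: "a \<le> n" and "A \<subseteq> {1..a}"
    using a A(1) R(1) by auto
  define D' where "D' = D \<inter> {a<..}"
  have cardD': "card D' + a = q + j"
  proof -
    have "card ({1..a} - D) + card ({1..a} \<inter> D) = a"
      using card_Diff_subset_Int[of "{1..a}" D] card_mono[of "{1..a}" "{1..a} \<inter> D"] by simp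
    moreover have "card D = card ({1..a} \<inter> D) + card D'"
    proof -
      have "D = ({1..a} \<inter> D) \<union> D'"
        by (auto simp: D'_def D_def)
      then show ?thesis
        using card_Un_disjoint[of "{1..a} \<inter> D" D'] cardD(2) by (fastforce simp: D'_def)
    qed
    ultimately show ?thesis
      using below A(2) cardD(1) by simp
  qed
  \<comment> \<open>Splitting off 1 leaves j - 1 distinct numbers up to a. In the resulting bound
    for s + a, the coefficient of a is j, the same as in q j.\<close>
  have s: "2 * s + (j - 1) * (j - 2) \<le> 2 * (j - 1) * a + 2"
  proof -
    have "s = Suc (\<Sum>(A - {1}))"
      unfolding s_def using sum.remove[OF finA one, of "\<lambda>x. x"] by simp
    moreover have "card (A - {1}) = j - 1"
      using one A(2) finA by simp
    moreover have "A - {1} \<subseteq> {..a}"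
      using a(2) by auto
    ultimately show ?thesis
      using sum_le_card[of "A - {1}" a] by (simp add: numeral_2_eq_2)
  qed
  have hit: "x \<in> D' \<or> x + s \<in> D'" if x: "x \<in> {a<..n - s}" for x
  proof (rule ccontr)
    assume "\<not> (x \<in> D' \<or> x + s \<in> D')"
    then have xR: "x \<in> R" "x + s \<in> R"
      using x by (auto simp: D'_def D_def)
    then have sub: "insert (x + s) (insert x A) \<subseteq> R"
      using A(1) by blast
    have xA: "x \<notin> A"
      using x a(2) by fastforce
    have "s > 0"
      unfolding s_def using one finA by (metis member_le_sum not_gr_zero not_one_le_zero zero_le)
    then have "x + s \<notin> insert x A"
      using x a(2)[of "x + s"] by auto
    moreover have "\<Sum>(insert x A) = x + s"
      using xA finA by (simp add: s_def)
    moreover have "inj_on c (insert (x + s) (insert x A))"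
      using sub by (rule inj_on_subset[OF injR])
    moreover have "card (insert x A) = m - 1"
      using xA finA A(2) j by simp
    ultimately show False
      using none rainbow_solution_of_set[of "insert x A" n m c] subset_trans[OF sub R(1)] m by auto
  qed
  \<comment> \<open>Differences y - s truncated to 0 only enlarge the covering set.\<close>
  have "{a<..n - s} \<subseteq> D' \<union> (\<lambda>y. y - s) ` D'"
    using hit by (force simp: image_iff)
  then have "card {a<..n - s} \<le> card (D' \<union> (\<lambda>y. y - s) ` D')"
    using cardD(2) by (intro card_mono) (auto simp: D'_def)
  also have "\<dots> \<le> card D' + card D'"
    using card_Un_le[of D' "(\<lambda>y. y - s) ` D'"] card_image_le[of D' "\<lambda>y. y - s"] cardD(2)
    by (auto simp: D'_def)
  finally have "n \<le> s + a + 2 * card D'"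
    by simp
  moreover define u where "u = card D'"
  ultimately have le: "int n \<le> int s + int a + 2 * int u" and ua: "u + a = q + j"
    using cardD' by auto
  obtain i where i: "j = i + 2"
    using j(2) by (metis add.commute le_Suc_ex)
  have q: "int q = int u + int a - int i - 2"
    using ua i by simp
  have "2 * s + (i + 1) * i \<le> 2 * (i + 1) * a + 2"
    using s unfolding i by simp
  then have "int (2 * s + (i + 1) * i) \<le> int (2 * (i + 1) * a + 2)"
    by (simp only: of_nat_le_iff)
  moreover have "int ((i + 4) * (i + 3) + 2 * q * (i + 2)) \<le> int (2 * n)"
    using n' unfolding i of_nat_le_iff by (simp add: algebra_simps)
  \<comment> \<open>Substituting q = u + a - j cancels all terms in a. What is left of u has
    coefficient 2 (j - 2) = 2 i, nonnegative because m is at least 4.\<close>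
  ultimately have "4 + 2 * (int i * int u) \<le> 2"
    using le by (simp add: q algebra_simps)
  moreover have "0 \<le> int i * int u"
    by simp
  ultimately show False
    by linarith
qed

section \<open>Lower bound: colorings without rainbow solutions\<close>

lemma exists_rainbow_free_coloring:
  assumes m: "m \<ge> 2" and n: "2 * n < m * (m - 1) + 2 * (q + 1) * (m - 2)"
    and r: "0 < r" "r + q + 1 \<le> n"
  shows "\<exists>c. exact_coloring r {1..n} c \<and> (\<nexists>x. solution m n x \<and> rainbow m c x)"
proof -
  \<comment> \<open>\<open>d\<close> sends 1, ..., q + 2 to 1 and each larger x to x - (q + 1);
    taking \<open>min r\<close> then merges all colors from r on.\<close>
  define d where "d = (\<lambda>x. max x (q + 2) - (q + 1))"
  define c where "c = (\<lambda>x. min r (d x))"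
  have "c ` {1..n} = {1..r}"
  proof
    show "c ` {1..n} \<subseteq> {1..r}"
      using r by (auto simp: c_def d_def)
    show "{1..r} \<subseteq> c ` {1..n}"
    proof
      fix k assume "k \<in> {1..r}"
      then show "k \<in> c ` {1..n}"
        using r by (intro image_eqI[of _ _ "k + q + 1"]) (auto simp: c_def d_def)
    qed
  qed
  then have "exact_coloring r {1..n} c"
    by (auto simp: exact_coloring_def coloring_def)
  moreover have False if sol: "solution m n x" and rb: "rainbow m c x" for x
  proof -
    let ?I = "{1..m - 1}"
    have inj: "inj_on (\<lambda>i. d (x i)) ?I"
    proof (rule inj_on_imageI2)
      show "inj_on (min r \<circ> (\<lambda>i. d (x i))) ?I"
        using rb unfolding rainbow_def c_def comp_def by (rule inj_on_subset) auto
    qed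
    have "(m - 1) * (m - 1 + 1) \<le> 2 * (\<Sum>i\<in>?I. d (x i))"
    proof -
      have "0 \<notin> (\<lambda>i. d (x i)) ` ?I"
        by (auto simp: d_def)
      then show ?thesis
        using sum_ge_card[of "(\<lambda>i. d (x i)) ` ?I"] inj
        by (simp add: card_image sum.reindex)
    qed
    moreover have "(\<Sum>i\<in>?I. d (x i)) + (m - 2) * (q + 1) \<le> (\<Sum>i\<in>?I. x i)"
    proof -
      \<comment> \<open>The values d (x i) are distinct, so \<open>T\<close> has at most one index.
        Off \<open>T\<close>, x i exceeds d (x i) by exactly q + 1; on \<open>T\<close>, it is at
        least 1 = d (x i).\<close>
      define T where "T = {i \<in> ?I. d (x i) = 1}"
      have "card T \<le> 1"
        using inj by (auto simp: T_def inj_on_def card_le_Suc0_iff_eq)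
      moreover have "card (?I - T) = (m - 1) - card T"
        by (subst card_Diff_subset) (auto simp: T_def)
      ultimately have T: "m - 2 \<le> card (?I - T)"
        by simp
      have pos: "x i \<ge> 1" if "i \<in> ?I" for i
        using sol that by (auto simp: solution_def Pi_iff)
      have "(\<Sum>i\<in>?I. d (x i)) + card (?I - T) * (q + 1)
          = (\<Sum>i\<in>?I. d (x i)) + (\<Sum>i\<in>?I. if i \<in> T then 0 else q + 1)"
        by (simp add: sum.If_cases Diff_eq)
      also have "\<dots> = (\<Sum>i\<in>?I. d (x i) + (if i \<in> T then 0 else q + 1))"
        by (simp add: sum.distrib)
      also have "\<dots> \<le> (\<Sum>i\<in>?I. x i)"
        using pos by (intro sum_mono) (auto simp: T_def d_def max_def split: if_splits)
      finally show ?thesis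
        using mult_le_mono1[OF T, of "q + 1"] by linarith
    qed
    moreover have "(\<Sum>i\<in>?I. x i) \<le> n"
      using sol m by (auto simp: solution_def Pi_iff)
    moreover have "m - 1 + 1 = m"
      using m by simp
    ultimately show False
      using n by (simp only: mult_ac)
  qed
  ultimately show ?thesis
    by blast
qed

section \<open>Combining both bounds and evaluating the ceiling\<close>

theorem theorem5:
  fixes m n :: nat
  assumes "m \<ge> 4"
    and "real n \<ge> real m * (real m - 1) / 2"
  shows "int (rainbow_schur m n) =
    \<lceil>((real m - 3) * real n + real m * (real m - 1) / 2) / (real m - 2)\<rceil>"
proof -
  define N where "N = m * (m - 1) div 2"
  have N2: "2 * N = m * (m - 1)"
    unfolding N_def by (intro dvd_mult_div_cancel) auto
  then have "2 * real N = real (m * (m - 1))"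
    by (metis of_nat_mult of_nat_numeral)
  then have N: "real m * (real m - 1) / 2 = real N"
    using assms(1) by (simp add: of_nat_diff)
  then have "N \<le> n"
    using assms(2) by simp
  define q where "q = (n - N) div (m - 2)"
  have "q * (m - 2) \<le> n - N" "n - N < (q + 1) * (m - 2)"
    using assms(1) dividend_less_div_times[of "m - 2" "n - N"] by (auto simp: q_def)
  then have q: "N + q * (m - 2) \<le> n" "n < N + (q + 1) * (m - 2)"
    using \<open>N \<le> n\<close> by auto
  \<comment> \<open>These estimates make n - q positive and its truncated subtraction exact.\<close>
  have "q * 1 \<le> q * (m - 2)"
    using assms(1) by (intro mult_le_mono2) simp
  moreover have "m * 1 \<le> m * (m - 1)"
    using assms(1) by (intro mult_le_mono2) simp
  ultimately have "q + 2 \<le> n"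
    using q(1) N2 assms(1) by linarith
  have "rainbow_schur m n = n - q"
    unfolding rainbow_schur_def
  proof (rule Least_equality, intro conjI allI impI)
    show "0 < n - q"
      using \<open>q + 2 \<le> n\<close> by simp
    show "\<exists>x. solution m n x \<and> rainbow m c x" if "exact_coloring (n - q) {1..n} c" for c
      using that assms(1) q(1) N2 \<open>q + 2 \<le> n\<close>
      by (intro exact_coloring_has_rainbow_solution[of "n - q"]) (auto simp: algebra_simps)
    show "n - q \<le> r"
      if r: "0 < r \<and> (\<forall>c. exact_coloring r {1..n} c \<longrightarrow> (\<exists>x. solution m n x \<and> rainbow m c x))" for r
    proof (rule ccontr)
      assume "\<not> n - q \<le> r"
      then have "r + q + 1 \<le> n"
        by simp
      moreover have "2 * n < m * (m - 1) + 2 * (q + 1) * (m - 2)"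
        using q(2) N2 by linarith
      ultimately show False
        using exists_rainbow_free_coloring[of m n q r] r assms(1) by auto
    qed
  qed
  \<comment> \<open>The numerator is (m - 2) n - (n - N), so the quotient is n - (n - N) / (m - 2),
    and q is the floor of the last fraction.\<close>
  moreover have "\<lceil>((real m - 3) * real n + real N) / (real m - 2)\<rceil> = int n - int q"
  proof -
    have "real (N + q * (m - 2)) \<le> real n" "real n < real (N + (q + 1) * (m - 2))"
      using q by (simp_all only: of_nat_le_iff of_nat_less_iff)
    then have "real N + real q * (real m - 2) \<le> real n"
      "real n < real N + real q * (real m - 2) + (real m - 2)"
      using assms(1) by (simp_all add: of_nat_diff)
    then show ?thesis
      using assms(1) by (intro ceiling_unique) (auto simp: field_simps)
  qed
  ultimately show ?thesis
    unfolding N using \<open>q + 2 \<le> n\<close> by simp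
qed

end
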